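(* Let $G$ and $B$ be sets (possibly infinite). For each $g \in G$ let $B_g \subseteq B$ and for each $b \in B$ let $G_b \subseteq G$ (these sets may be infinite). Put $G_L = \{g \in G : B_g \neq \varnothing\}$ and $B_L = \{b \in B : G_b \neq \varnothing\}$. For $g \in G_L$ let $B^*_g = \{b \in B_g : b \notin B_L \text{ or } g \in G_b\}$, and for $b \in B_L$ let $G^*_b = \{g \in G_b : g \notin G_L \text{ or } b \in B_g\}$. Then there exists an injective partial function $P : G \to B$ with $G_L \subseteq \mathrm{Domain}(P)$, $B_L \subseteq \mathrm{Range}(P)$, $P(g) \in B_g$ for all $g \in G_L$, and $P^{-1}(b) \in G_b$ for all $b \in B_L$, if and only if both of the following hold: (i) there is an injective function $T_1 : G_L \to B$ with $T_1(g) \in B^*_g$ for all $g \in G_L$; (ii) there is an injective function $T_2 : B_L \to G$ with $T_2(b) \in G^*_b$ for all $b \in B_L$.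
   Context: This is the (possibly infinite) "Symmetric Marriage Problem": $B_g$ is the list of boys girl $g$ is willing to marry and $G_b$ the list of girls boy $b$ is willing to marry; an empty list means the person has no list (is willing to marry anyone or no one). $G_L$, $B_L$ are the girls and boys with lists. *)

theory Defs
  imports Main "HOL-Library.FuncSet"
begin

text \<open>
  The two sides of the problem are symmetric, so these two notions are defined once for a set
  \<open>X\<close> of people whose lists are \<open>L\<close> and the opposite side \<open>Y\<close> whose lists are \<open>M\<close>.  The girls'
  version of a notion arises with \<open>X = G\<close> and \<open>Y = B\<close>, the boys' version with the roles exchanged.
\<close>

definition having_list :: "'a set \<Rightarrow> ('a \<Rightarrow> 'b set) \<Rightarrow> 'a set" where
  "having_list X L = {x \<in> X. L x \<noteq> {}}"

definition star_list :: "'b set \<Rightarrow> ('b \<Rightarrow> 'a set) \<Rightarrow> ('a \<Rightarrow> 'b set) \<Rightarrow> 'a \<Rightarrow> 'b set" where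
  "star_list Y M L x = {y \<in> L x. y \<notin> having_list Y M \<or> x \<in> M y}"

text \<open>
  A partial function from \<open>G\<close> to \<open>B\<close> is a map with domain in \<open>G\<close> and range in \<open>B\<close>.  Its values
  at \<open>g \<in> dom P\<close> and its inverse at \<open>b \<in> ran P\<close> are \<open>the (P g)\<close> and \<open>inv_into (dom P) P (Some b)\<close>;
  both are applied below only to people with lists, who are required to lie in \<open>dom P\<close> and
  \<open>ran P\<close> respectively.
\<close>

definition injective_partial :: "'g set \<Rightarrow> 'b set \<Rightarrow> ('g \<rightharpoonup> 'b) \<Rightarrow> bool" where
  "injective_partial G B P \<longleftrightarrow> dom P \<subseteq> G \<and> ran P \<subseteq> B \<and> inj_on P (dom P)"

definition symmetric_marriage ::
  "'g set \<Rightarrow> 'b set \<Rightarrow> ('g \<Rightarrow> 'b set) \<Rightarrow> ('b \<Rightarrow> 'g set) \<Rightarrow> ('g \<rightharpoonup> 'b) \<Rightarrow> bool" where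
  "symmetric_marriage G B Bs Gs P \<longleftrightarrow>
     injective_partial G B P \<and>
     having_list G Bs \<subseteq> dom P \<and>
     having_list B Gs \<subseteq> ran P \<and>
     (\<forall>g \<in> having_list G Bs. the (P g) \<in> Bs g) \<and>
     (\<forall>b \<in> having_list B Gs. inv_into (dom P) P (Some b) \<in> Gs b)"

end

(* Given injections f of X (the girls with lists) and h of Y (the boys with lists), let the girls
   in A \<subseteq> X marry along f and the boys in Y - f ` A along h.  This is a matching covering X and Y
   as soon as A = X - h ` (Y - f ` A), and the right-hand side is monotone in A, so a fixed point
   exists by Knaster-Tarski, as in the Cantor-Bernstein theorem. *)

theory Submission
  imports Defs
begin

lemma inj_on_map_inv_into:
  assumes "inj_on P (dom P)" and "P x = Some y"
  shows "inv_into (dom P) P (Some y) = x"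
  using assms by (metis domI inv_into_f_f)

text \<open>Restates the list conditions edge by edge, free of \<open>the\<close> and
  \<open>inv_into\<close>, so that girls and boys enter symmetrically. Both directions of the final
  equivalence work with this form.\<close>

lemma symmetric_marriage_iff:
  "symmetric_marriage G B Bs Gs P \<longleftrightarrow>
     injective_partial G B P \<and> having_list G Bs \<subseteq> dom P \<and> having_list B Gs \<subseteq> ran P \<and>
     (\<forall>g b. P g = Some b \<longrightarrow>
        (g \<in> having_list G Bs \<longrightarrow> b \<in> Bs g) \<and> (b \<in> having_list B Gs \<longrightarrow> g \<in> Gs b))"
\<comment> \<open>If this conjunction fails, both sides are false. If it holds, \<open>the\<close>
  and \<open>inv_into\<close> are only applied where they return the actual partner.\<close>
proof (cases "injective_partial G B P \<and> having_list G Bs \<subseteq> dom P \<and> having_list B Gs \<subseteq> ran P")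
  case True
  then have inj: "inj_on P (dom P)"
    by (simp add: injective_partial_def)
  have "(\<forall>g \<in> having_list G Bs. the (P g) \<in> Bs g) \<longleftrightarrow>
      (\<forall>g b. P g = Some b \<longrightarrow> g \<in> having_list G Bs \<longrightarrow> b \<in> Bs g)"
    using True by (force simp: dom_def)
  moreover have "(\<forall>b \<in> having_list B Gs. inv_into (dom P) P (Some b) \<in> Gs b) \<longleftrightarrow>
      (\<forall>g b. P g = Some b \<longrightarrow> b \<in> having_list B Gs \<longrightarrow> g \<in> Gs b)" (is "?L \<longleftrightarrow> ?R")
  proof
    assume ?L
    then show ?R
      using inj_on_map_inv_into[OF inj] by metis
  next
    assume R: ?R
    show ?L
    proof
      fix b
      assume b: "b \<in> having_list B Gs"
      then obtain g where "P g = Some b"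
        using True by (auto simp: ran_def)
      then show "inv_into (dom P) P (Some b) \<in> Gs b"
        using R b inj_on_map_inv_into[OF inj] by metis
    qed
  qed
  ultimately show ?thesis
    using True by (auto simp: symmetric_marriage_def)
qed (auto simp: symmetric_marriage_def)

text \<open>Unlike in Cantor-Bernstein, \<open>f\<close> may leave \<open>Y\<close> and
  \<open>h\<close> may leave \<open>X\<close>, so \<open>P\<close> may also match people outside
  \<open>X\<close> and \<open>Y\<close>. The last clause says that every edge of \<open>P\<close>
  comes from \<open>f\<close> or from \<open>h\<close>; through it the list conditions carry over to
  \<open>P\<close>.\<close>

theorem mendelsohn_dulmage:
  fixes f :: "'a \<Rightarrow> 'b" and h :: "'b \<Rightarrow> 'a"
  assumes f: "inj_on f X" and h: "inj_on h Y"
  obtains P where "inj_on P (dom P)" "X \<subseteq> dom P" "Y \<subseteq> ran P"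
    "\<And>x y. P x = Some y \<Longrightarrow> x \<in> X \<and> y = f x \<or> y \<in> Y \<and> x = h y"
proof -
  define A where "A = lfp (\<lambda>A. X - h ` (Y - f ` A))"
  have "mono (\<lambda>A. X - h ` (Y - f ` A))"
    by (intro monoI) blast
  then have A: "A = X - h ` (Y - f ` A)"
    unfolding A_def by (rule lfp_unfold)
  \<comment> \<open>The edges along \<open>h\<close> start at boys, so seen from the girls they are
    given by the inverse of \<open>h\<close>.\<close>
  define P where "P x = (if x \<in> A then Some (f x)
      else if x \<in> h ` (Y - f ` A) then Some (inv_into Y h x) else None)" for x
  have P_iff: "P x = Some y \<longleftrightarrow> x \<in> A \<and> y = f x \<or> y \<in> Y - f ` A \<and> x = h y" for x y
  proof -
    \<comment> \<open>By the fixed point equation the two branches of \<open>P\<close> never compete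
      for the same girl.\<close>
    have "h y \<notin> A" if "y \<in> Y - f ` A" for y
      using A that by blast
    then show ?thesis
      using h by (auto simp: P_def)
  qed
  show thesis
  proof
    show "inj_on P (dom P)"
    proof (rule inj_onI)
      fix x x'
      assume "x \<in> dom P" and eq: "P x = P x'"
      then obtain y where "P x = Some y" "P x' = Some y"
        by (metis domD)
      moreover have "inj_on f A"
        using A f by (metis Diff_subset inj_on_subset)
      ultimately show "x = x'"
        unfolding P_iff by (auto dest: inj_onD)
    qed
    show "X \<subseteq> dom P"
    proof
      fix x
      assume "x \<in> X"
      then have "x \<in> A \<or> x \<in> h ` (Y - f ` A)"
        using A by blast
      then have "\<exists>y. P x = Some y"
        unfolding P_iff by blast
      then show "x \<in> dom P"
        by blast
    qed
    show "Y \<subseteq> ran P"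
      unfolding ran_def P_iff by blast
    show "x \<in> X \<and> y = f x \<or> y \<in> Y \<and> x = h y" if "P x = Some y" for x y
      using that A unfolding P_iff by blast
  qed
qed

theorem theorem4:
  fixes G :: "'g set" and B :: "'b set"
    and Bs :: "'g \<Rightarrow> 'b set" and Gs :: "'b \<Rightarrow> 'g set"
  assumes "\<And>g. g \<in> G \<Longrightarrow> Bs g \<subseteq> B"
    and "\<And>b. b \<in> B \<Longrightarrow> Gs b \<subseteq> G"
  shows "(\<exists>P. symmetric_marriage G B Bs Gs P) \<longleftrightarrow>
    (\<exists>T\<^sub>1. T\<^sub>1 \<in> having_list G Bs \<rightarrow> B \<and> inj_on T\<^sub>1 (having_list G Bs) \<and>
       (\<forall>g \<in> having_list G Bs. T\<^sub>1 g \<in> star_list B Gs Bs g)) \<and>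
    (\<exists>T\<^sub>2. T\<^sub>2 \<in> having_list B Gs \<rightarrow> G \<and> inj_on T\<^sub>2 (having_list B Gs) \<and>
       (\<forall>b \<in> having_list B Gs. T\<^sub>2 b \<in> star_list G Bs Gs b))"
proof -
  let ?X = "having_list G Bs" and ?Y = "having_list B Gs"
  show ?thesis
  proof (intro iffI; (elim exE conjE)?)
    fix P
    assume "symmetric_marriage G B Bs Gs P"
    then have inj: "inj_on P (dom P)" and domran: "dom P \<subseteq> G" "ran P \<subseteq> B"
      and cover: "?X \<subseteq> dom P" "?Y \<subseteq> ran P"
      and lists: "\<And>g b. P g = Some b \<Longrightarrow> g \<in> ?X \<Longrightarrow> b \<in> Bs g"
        "\<And>g b. P g = Some b \<Longrightarrow> b \<in> ?Y \<Longrightarrow> g \<in> Gs b"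
      by (auto simp: symmetric_marriage_iff injective_partial_def)
    define T where "T g = the (P g)" for g
    define Q where "Q b = inv_into (dom P) P (Some b)" for b
    have T: "P g = Some (T g)" if "g \<in> ?X" for g
      using cover that by (auto simp: T_def)
    have Q: "P (Q b) = Some b" if b: "b \<in> ?Y" for b
    proof -
      obtain g where "P g = Some b"
        using cover b by (auto simp: ran_def)
      then show ?thesis
        unfolding Q_def by (metis f_inv_into_f domI imageI)
    qed
    show "(\<exists>T\<^sub>1. T\<^sub>1 \<in> ?X \<rightarrow> B \<and> inj_on T\<^sub>1 ?X \<and> (\<forall>g \<in> ?X. T\<^sub>1 g \<in> star_list B Gs Bs g)) \<and>
      (\<exists>T\<^sub>2. T\<^sub>2 \<in> ?Y \<rightarrow> G \<and> inj_on T\<^sub>2 ?Y \<and> (\<forall>b \<in> ?Y. T\<^sub>2 b \<in> star_list G Bs Gs b))"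
    proof (intro conjI exI ballI)
      show "T \<in> ?X \<rightarrow> B"
        using domran ranI[of P, OF T] by blast
      show "inj_on T ?X"
        using cover by (intro inj_onI inj_onD[OF inj]) (metis T subsetD)+
      \<comment> \<open>The edge from \<open>g\<close> to \<open>T g\<close> respects the lists at
        both of its ends, which is what a starred list records.\<close>
      show "T g \<in> star_list B Gs Bs g" if "g \<in> ?X" for g
        using T[OF that] lists that unfolding star_list_def by blast
      show "Q \<in> ?Y \<rightarrow> G"
        using domran domI[of P, OF Q] by blast
      show "inj_on Q ?Y"
        using Q by (metis inj_onI option.inject)
      show "Q b \<in> star_list G Bs Gs b" if "b \<in> ?Y" for b
        using Q[OF that] lists that unfolding star_list_def by blast
    qed
  next
    fix T\<^sub>1 T\<^sub>2
    assume T1: "T\<^sub>1 \<in> ?X \<rightarrow> B" "inj_on T\<^sub>1 ?X" "\<forall>g \<in> ?X. T\<^sub>1 g \<in> star_list B Gs Bs g"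
      and T2: "T\<^sub>2 \<in> ?Y \<rightarrow> G" "inj_on T\<^sub>2 ?Y" "\<forall>b \<in> ?Y. T\<^sub>2 b \<in> star_list G Bs Gs b"
    obtain P where P: "inj_on P (dom P)" "?X \<subseteq> dom P" "?Y \<subseteq> ran P"
      and edge: "\<And>g b. P g = Some b \<Longrightarrow> g \<in> ?X \<and> b = T\<^sub>1 g \<or> b \<in> ?Y \<and> g = T\<^sub>2 b"
      using mendelsohn_dulmage[OF T1(2) T2(2)] by blast
    have "g \<in> G \<and> b \<in> B" if "P g = Some b" for g b
      using edge[OF that] T1(1) T2(1) by (auto simp: having_list_def)
    then have "injective_partial G B P"
      using P(1) by (auto simp: injective_partial_def ran_def)
    \<comment> \<open>Here the starred lists are essential: an edge taken from
      \<open>T\<^sub>1\<close> also respects the boy's list if he has one, and an edge from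
      \<open>T\<^sub>2\<close> the girl's, so mixing the two breaks no condition.\<close>
    moreover have "(g \<in> ?X \<longrightarrow> b \<in> Bs g) \<and> (b \<in> ?Y \<longrightarrow> g \<in> Gs b)" if "P g = Some b" for g b
      using edge[OF that] T1(3) T2(3) by (auto simp: star_list_def)
    ultimately show "\<exists>P. symmetric_marriage G B Bs Gs P"
      using P by (auto simp: symmetric_marriage_iff)
  qed
qed

end
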